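(* Let $n$ be a positive integer. If the base-$b$ representation of $2^n$ (for some integer $b>1$) is a 3-digit representation of binomial form, i.e. $2^n=\alpha(1,2,1)_b$ meaning $2^n=\alpha+2\alpha b+\alpha b^2$ with $\alpha$ a positive integer and $2\alpha<b$, then $\alpha=2^i$ and $b=2^{(n-i)/2}-1$ for some integer $i$ with $0\le 3i<n-2$ and $n\equiv i\pmod 2$.
   Context: For an integer $b>1$, every positive integer $N$ can be written uniquely as $N=\sum_{i=0}^m c_i b^i$ with integers $0\le c_i<b$ and $c_m>0$; this is written $N=(c_m,\ldots,c_0)_b$. A representation has binomial form if its digits are $\alpha\binom{m}{m},\alpha\binom{m}{m-1},\ldots,\alpha\binom{m}{0}$ for some positive integer $\alpha$; for three digits ($m=2$) this is $\alpha(1,2,1)_b$. *)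

theory Defs
  imports Main "HOL-Number_Theory.Cong"
begin

text \<open>Digit lists are written with the most significant digit first, i.e. \<open>[c\<^sub>m, \<dots>, c\<^sub>0]\<close>
  stands for \<open>(c\<^sub>m, \<dots>, c\<^sub>0)\<^sub>b\<close>. Since \<open>horner_sum\<close> expects the least significant
  digit first, the list is reversed.\<close>

definition base_representation :: "nat \<Rightarrow> nat \<Rightarrow> nat list \<Rightarrow> bool" where
  "base_representation b N cs \<longleftrightarrow>
     cs \<noteq> [] \<and> hd cs > 0 \<and> (\<forall>c\<in>set cs. c < b) \<and> N = horner_sum id b (rev cs)"

definition binomial_digits :: "nat \<Rightarrow> nat \<Rightarrow> nat list" where
  "binomial_digits \<alpha> m = map (\<lambda>j. \<alpha> * (m choose j)) (rev [0..<Suc m])"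

lemma base_representation_sum:
  "base_representation b N cs \<longleftrightarrow>
     cs \<noteq> [] \<and> hd cs > 0 \<and> (\<forall>c\<in>set cs. c < b) \<and> N = (\<Sum>i<length cs. rev cs ! i * b ^ i)"
  by (simp add: base_representation_def horner_sum_eq_sum atLeast0LessThan)

lemma binomial_digits_2: "binomial_digits \<alpha> 2 = [\<alpha>, 2 * \<alpha>, \<alpha>]"
  by (simp add: binomial_digits_def numeral_2_eq_2)

lemma base_representation_binomial_digits_2:
  "base_representation b N (binomial_digits \<alpha> 2) \<longleftrightarrow>
     \<alpha> > 0 \<and> 2 * \<alpha> < b \<and> N = \<alpha> + 2 * \<alpha> * b + \<alpha> * b ^ 2"
  by (auto simp: base_representation_def binomial_digits_2 algebra_simps power2_eq_square)

end

theory Submission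
  imports Defs
begin

text \<open>The digits 1, 2, 1 are the coefficients of \<open>(b + 1) ^ 2\<close>, so the
  representation says \<open>2 ^ n = \<alpha> * (b + 1) ^ 2\<close>. Every divisor of a power of two
  is a power of two, hence \<open>\<alpha> = 2 ^ i\<close> and \<open>b + 1 = 2 ^ k\<close>.
  Comparing exponents gives \<open>n = i + 2 * k\<close>, which settles the parity and the value of
  b; the digit bound on the middle digit limits i.\<close>

theorem theorem2p2:
  fixes n b \<alpha> :: nat
  assumes "n > 0" and "b > 1" and "\<alpha> > 0"
    and "base_representation b (2 ^ n) (binomial_digits \<alpha> 2)"
  shows "\<exists>i::nat. \<alpha> = 2 ^ i \<and> int b = 2 ^ ((n - i) div 2) - 1
           \<and> 3 * int i < int n - 2 \<and> [n = i] (mod 2)"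
proof -
  have digit: "2 * \<alpha> < b" and "2 ^ n = \<alpha> + 2 * \<alpha> * b + \<alpha> * b ^ 2"
    using assms(4) unfolding base_representation_binomial_digits_2 by auto
  then have fact: "2 ^ n = \<alpha> * (b + 1) ^ 2"
    by (simp add: power2_eq_square algebra_simps)
  have two: "prime (2 :: nat)"
    by (rule two_is_prime_nat)
  have "\<alpha> dvd 2 ^ n" and "b + 1 dvd 2 ^ n"
    unfolding fact by (rule dvd_triv_left, rule dvd_mult, rule dvd_power, simp)
  then obtain i k where i: "\<alpha> = 2 ^ i" and k: "b + 1 = 2 ^ k"
    unfolding divides_primepow_nat[OF two] by blast
  have "(2 :: nat) ^ n = 2 ^ (i + 2 * k)"
    using fact unfolding i k by (simp add: power_add power_mult mult.commute flip: power_mult)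
  then have n: "n = i + 2 * k"
    by simp
  \<comment> \<open>The middle digit 2\<alpha> is itself a power of two, lying below
    \<open>b\<close> and so below \<open>b + 1\<close>.\<close>
  have "(2 :: nat) ^ Suc i < 2 ^ k"
    using digit i k by simp
  then have "Suc i < k"
    by (rule power_less_imp_less_exp[rotated]) simp
  moreover have "int b = 2 ^ k - 1"
    using arg_cong[OF k, of int] by simp
  \<comment> \<open>Here \<open>k\<close> is \<open>(n - i) div 2\<close>, and
    \<open>Suc i < k\<close> gives \<open>3 * i + 2 < i + 2 * k = n\<close>.\<close>
  ultimately have "\<alpha> = 2 ^ i \<and> int b = 2 ^ ((n - i) div 2) - 1
      \<and> 3 * int i < int n - 2 \<and> [n = i] (mod 2)"
    using i n by (simp add: cong_def)
  then show ?thesis ..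
qed

end
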